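(* Let $n=2$. Consider a family, indexed by $\varepsilon\in\mathbb{R}$, of systems $$u_t+f(u;\varepsilon)_x=(D^\varepsilon u_x)_x,\qquad u\in\mathbb{R}^2,$$ with $D^\varepsilon$ a real $2\times2$ matrix independent of $u$. Let $u_0\in\mathbb{R}^2$ be a uniform state and let $A^\varepsilon:=d_uf(u_0;\varepsilon)$ be the real $2\times 2$ Jacobian matrix, so that the linearization about $u\equiv u_0$ is $u_t=-A^\varepsilon u_x+D^\varepsilon u_{xx}$. Assume that for every $\varepsilon$: (i) $A^\varepsilon$ is diagonal with distinct diagonal entries; and (ii) $D^\varepsilon$ has positive diagonal entries, and all eigenvalues of $D^\varepsilon$ have strictly positive real part. Then no Turing-type instability occurs: there is no value $\varepsilon_*\in\mathbb{R}$ at which the family undergoes a Turing instability, in the sense defined in the context.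
   Context: Notation: $\sigma(M)$ denotes the spectrum of a complex square matrix $M$, and $\Re\sigma(M)$ the set of real parts of its eigenvalues. A bound $\Re\sigma(M)\le b$ means that every eigenvalue of $M$ has real part at most $b$. Stability condition: the uniform state $u_0$ is spectrally stable at parameter $\varepsilon$ if there is $\theta>0$ such that $$\Re\sigma(-i\xi A^\varepsilon-\xi^2D^\varepsilon)\le-\theta|\xi|^2\qquad\text{for all }\xi\in\mathbb{R}.$$ Turing instability: the family undergoes a Turing(-type) instability at $\varepsilon=\varepsilon_*$ if there is $\xi_*>0$ such that the following three conditions hold. (a) At $\varepsilon=\varepsilon_*$, $$\max_{\xi\in\mathbb{R}\setminus\{0\}}\ \max\Re\sigma(-i\xi A^{\varepsilon_*}-\xi^2D^{\varepsilon_*})=0,$$ and this maximum is achieved at $\xi=\pm\xi_*$. That is, $-i\xi A^{\varepsilon_*}-\xi^2D^{\varepsilon_*}$ has a purely imaginary (possibly zero) eigenvalue at $\xi=\pm\xi_*\neq0$, and no eigenvalue of positive real part for any $\xi\ne0$. (b) The stability bound holds uniformly away from $\pm\xi_*$: for each $\delta>0$ there is $\theta>0$ such that $\Re\sigma(-i\xi A^{\varepsilon_*}-\xi^2D^{\varepsilon_*})\le-\theta|\xi|^2$ for all $\xi\in\mathbb{R}$ with $\big||\xi|-\xi_*\big|\ge\delta$. (c) Stability fails strictly as $\varepsilon$ increases past $\varepsilon_*$: for all $\varepsilon>\varepsilon_*$ sufficiently close to $\varepsilon_*$, there is $\xi\in\mathbb{R}$ such that $-i\xi A^\varepsilon-\xi^2D^\varepsilon$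 has an eigenvalue of strictly positive real part. *)

theory Defs
  imports "HOL-Analysis.Analysis"
begin

definition spectrum :: "complex^'n^'n \<Rightarrow> complex set" where
  "spectrum M = {l. \<exists>v. v \<noteq> 0 \<and> M *v v = l *s v}"

(* Every square complex matrix has a finite nonempty spectrum, so Max is a genuine maximum. *)
definition max_Re_spectrum :: "complex^'n^'n \<Rightarrow> real" where
  "max_Re_spectrum M = Max (Re ` spectrum M)"

definition Re_spectrum_le :: "complex^'n^'n \<Rightarrow> real \<Rightarrow> bool" where
  "Re_spectrum_le M b \<longleftrightarrow> (\<forall>l\<in>spectrum M. Re l \<le> b)"

(* Fourier symbol - i xi A - xi^2 D of the linearized operator u_t = - A u_x + D u_xx. *)
definition fourier_symbol :: "real^'n^'n \<Rightarrow> real^'n^'n \<Rightarrow> real \<Rightarrow> complex^'n^'n" where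
  "fourier_symbol A D \<xi> =
     (\<chi> i j. - \<i> * of_real \<xi> * of_real (A $ i $ j) - (of_real \<xi>)^2 * of_real (D $ i $ j))"

definition turing_instability_at ::
    "(real \<Rightarrow> real^'n^'n) \<Rightarrow> (real \<Rightarrow> real^'n^'n) \<Rightarrow> real \<Rightarrow> bool" where
  "turing_instability_at A D \<epsilon>s \<longleftrightarrow>
     (\<exists>\<xi>s>0.
        ((\<forall>\<xi>. \<xi> \<noteq> 0 \<longrightarrow> max_Re_spectrum (fourier_symbol (A \<epsilon>s) (D \<epsilon>s) \<xi>) \<le> 0) \<and>
         max_Re_spectrum (fourier_symbol (A \<epsilon>s) (D \<epsilon>s) \<xi>s) = 0 \<and>
         max_Re_spectrum (fourier_symbol (A \<epsilon>s) (D \<epsilon>s) (- \<xi>s)) = 0) \<and>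
        (\<forall>\<delta>>0. \<exists>\<theta>>0. \<forall>\<xi>. \<bar>\<bar>\<xi>\<bar> - \<xi>s\<bar> \<ge> \<delta> \<longrightarrow>
           Re_spectrum_le (fourier_symbol (A \<epsilon>s) (D \<epsilon>s) \<xi>) (- \<theta> * \<bar>\<xi>\<bar>^2)) \<and>
        (\<forall>\<^sub>F \<epsilon> in at_right \<epsilon>s. \<exists>\<xi>. \<exists>l\<in>spectrum (fourier_symbol (A \<epsilon>) (D \<epsilon>) \<xi>). Re l > 0))"

end

theory Submission
  imports Defs
begin

text \<open>
  A diagonal convection matrix never destabilizes two diffusing components: every eigenvalue of the
  Fourier symbol has strictly negative real part at every nonzero frequency, so the neutral mode
  required at the critical frequency cannot exist.

  To see this, let \<open>l\<close> be an eigenvalue of \<open>- \<i> \<xi> A - \<xi>\<^sup>2 D\<close> with \<open>A\<close> diagonal, so that \<open>w v = \<xi>\<^sup>4 b c\<close>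
  where \<open>w = l + \<i> \<xi> a\<^sub>1 + \<xi>\<^sup>2 d\<^sub>1\<close>, \<open>v = l + \<i> \<xi> a\<^sub>2 + \<xi>\<^sup>2 d\<^sub>2\<close>, and \<open>b\<close>, \<open>c\<close> are the off-diagonal entries
  of \<open>D\<close>. The diagonality of \<open>A\<close> makes the right-hand side real. If \<open>Re l \<ge> 0\<close>, then \<open>w\<close> and
  \<open>v\<close> lie in the open right half-plane, and since their product is real their arguments are
  opposite; hence \<open>w v = \<bar>w\<bar> \<bar>v\<bar> \<ge> Re w Re v \<ge> \<xi>\<^sup>4 d\<^sub>1 d\<^sub>2\<close>
  (lemma \<open>Re_mult_ge_if_real\<close>). This contradicts \<open>b c < d\<^sub>1 d\<^sub>2\<close>, which is the positivity of
  \<open>det D\<close> (lemma \<open>det_pos_if_spectrum_pos\<close>).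
\<close>

lemma spectrum_iff_det: "l \<in> spectrum M \<longleftrightarrow> det (M - mat l) = 0"
proof -
  have shift: "(M - mat l) *v v = M *v v - l *s v" for v
  proof -
    have "mat l *v v = l *s v"
      by (simp add: mat_def matrix_vector_mult_def vec_eq_iff if_distribR if_distrib cong: if_cong)
    then show ?thesis
      by (simp add: matrix_vector_mult_diff_rdistrib)
  qed
  have "det (M - mat l) = 0 \<longleftrightarrow> \<not> (\<exists>B. B ** (M - mat l) = mat 1)"
    by (metis invertible_det_nz invertible_def invertible_left_inverse)
  then show ?thesis
    unfolding spectrum_def by (auto simp: matrix_left_invertible_ker shift)
qed

lemma spectrum_2_iff:
  fixes M :: "complex^2^2"
  shows "l \<in> spectrum M \<longleftrightarrow> (M$1$1 - l) * (M$2$2 - l) = M$1$2 * M$2$1"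
  by (simp add: spectrum_iff_det det_2 mat_def)

text \<open>The spectrum is finite and nonempty, so that its maximal real part is that of an actual
  eigenvalue.\<close>

lemma spectrum_2_pair:
  fixes M :: "complex^2^2"
  shows "\<exists>r s. spectrum M = {r, s}"
proof -
  define t where "t = M$1$1 + M$2$2"
  define d where "d = M$1$1 * M$2$2 - M$1$2 * M$2$1"
  define q where "q = csqrt (t^2 - 4 * d)"
  have q2: "q^2 = t^2 - 4 * d"
    by (simp add: q_def)
  have "l \<in> spectrum M \<longleftrightarrow> l = (t + q)/2 \<or> l = (t - q)/2" for l
  proof -
    have "(l - (t + q)/2) * (l - (t - q)/2) = l^2 - t * l + (t^2 - q^2)/4"
      by (simp add: field_simps power2_eq_square)
    also have "\<dots> = (M$1$1 - l) * (M$2$2 - l) - M$1$2 * M$2$1"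
      unfolding q2 by (simp add: t_def d_def algebra_simps diff_divide_distrib power2_eq_square)
    finally show ?thesis
      unfolding spectrum_2_iff by (metis eq_iff_diff_eq_0 mult_eq_0_iff)
  qed
  then show ?thesis by blast
qed

lemma max_Re_spectrum_attained:
  fixes M :: "complex^2^2"
  shows "\<exists>l\<in>spectrum M. Re l = max_Re_spectrum M"
proof -
  obtain r s where "spectrum M = {r, s}"
    using spectrum_2_pair by blast
  then show ?thesis
    unfolding max_Re_spectrum_def by (auto simp: max_def)
qed

text \<open>The two eigenvalues are either conjugate or both real, and in either case their product is
  positive. Contrapositively, a nonpositive determinant makes the discriminant at least the square
  of the trace, and the smaller root is then a real eigenvalue that is not positive.\<close>

lemma det_pos_if_spectrum_pos:
  fixes D :: "real^2^2"
  assumes pos: "\<And>l. l \<in> spectrum (map_matrix complex_of_real D) \<Longrightarrow> Re l > 0"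
  shows "D$1$2 * D$2$1 < D$1$1 * D$2$2"
proof (rule ccontr)
  assume neg: "\<not> ?thesis"
  define t where "t = D$1$1 + D$2$2"
  define d where "d = D$1$1 * D$2$2 - D$1$2 * D$2$1"
  define x where "x = (t - sqrt (t^2 - 4 * d)) / 2"
  have d: "d \<le> 0"
    using neg by (simp add: d_def)
  have "t \<le> sqrt (t^2 - 4 * d)"
    by (rule real_le_rsqrt) (use d in simp)
  then have x: "x \<le> 0"
    by (simp add: x_def)
  have "0 \<le> t^2 - 4 * d"
    using d zero_le_power2[of t] by linarith
  then have "(t - 2 * x)^2 = t^2 - 4 * d"
    by (simp add: x_def diff_divide_distrib)
  then have "(D$1$1 - x) * (D$2$2 - x) = D$1$2 * D$2$1"
    by (simp add: t_def d_def power2_eq_square algebra_simps)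
  then have "complex_of_real x \<in> spectrum (map_matrix complex_of_real D)"
    by (simp add: spectrum_2_iff map_matrix_def flip: of_real_mult of_real_diff)
  from pos[OF this] x show False
    by simp
qed

text \<open>Two numbers in the right half-plane with real product have opposite arguments, so their
  imaginary parts can only increase the real part of the product.\<close>

lemma Re_mult_ge_if_real:
  assumes "Re w > 0" "Re v > 0" "Im (w * v) = 0"
  shows "Re w * Re v \<le> Re (w * v)"
proof -
  have Im_v: "Im v = - Im w * Re v / Re w"
    using assms by (simp add: field_simps)
  have "Im w * Im v = - ((Im w)^2 * Re v / Re w)"
    by (simp add: Im_v power2_eq_square)
  also have "\<dots> \<le> 0"
    using assms by simp
  finally show ?thesis
    by simp
qed

lemma Re_spectrum_fourier_symbol_neg:
  fixes A D :: "real^2^2"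
  assumes diag: "A$1$2 = 0" "A$2$1 = 0"
    and D_diag: "D$1$1 > 0" "D$2$2 > 0"
    and det: "D$1$2 * D$2$1 < D$1$1 * D$2$2"
    and \<xi>: "\<xi> \<noteq> 0"
    and l: "l \<in> spectrum (fourier_symbol A D \<xi>)"
  shows "Re l < 0"
proof (rule ccontr)
  assume "\<not> Re l < 0"
  then have l0: "Re l \<ge> 0"
    by simp
  define w where "w = l + \<i> * of_real (\<xi> * A$1$1) + of_real (\<xi>^2 * D$1$1)"
  define v where "v = l + \<i> * of_real (\<xi> * A$2$2) + of_real (\<xi>^2 * D$2$2)"
  have wv: "w * v = of_real (\<xi>^4 * (D$1$2 * D$2$1))"
    using l diag
    by (simp add: spectrum_2_iff fourier_symbol_def w_def v_def algebra_simps power4_eq_xxxx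
        power2_eq_square)
  have Re_w: "\<xi>^2 * D$1$1 \<le> Re w" and Re_v: "\<xi>^2 * D$2$2 \<le> Re v"
    using l0 by (simp_all add: w_def v_def)
  have pos: "0 < \<xi>^2 * D$1$1" "0 < \<xi>^2 * D$2$2"
    using \<xi> D_diag by simp_all
  have "\<xi>^4 * (D$1$1 * D$2$2) = (\<xi>^2 * D$1$1) * (\<xi>^2 * D$2$2)"
    by (simp add: power4_eq_xxxx power2_eq_square)
  also have "\<dots> \<le> Re w * Re v"
    using Re_w Re_v pos by (intro mult_mono) auto
  also have "\<dots> \<le> Re (w * v)"
    using Re_w Re_v pos by (intro Re_mult_ge_if_real) (auto simp only: wv Im_complex_of_real)
  also have "\<dots> = \<xi>^4 * (D$1$2 * D$2$1)"
    by (simp only: wv Re_complex_of_real)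
  also have "\<dots> < \<xi>^4 * (D$1$1 * D$2$2)"
    using det \<xi> by (intro mult_strict_left_mono) simp_all
  finally show False
    by simp
qed

theorem proposition3p1:
  fixes f :: "real^2 \<Rightarrow> real \<Rightarrow> real^2"
    and D A :: "real \<Rightarrow> real^2^2"
    and u\<^sub>0 :: "real^2"
  assumes "\<And>\<epsilon>. (\<lambda>u. f u \<epsilon>) differentiable (at u\<^sub>0)"
    and "\<And>\<epsilon>. A \<epsilon> = jacobian (\<lambda>u. f u \<epsilon>) (at u\<^sub>0)"
    and "\<And>\<epsilon> i j. i \<noteq> j \<Longrightarrow> A \<epsilon> $ i $ j = 0"
    and "\<And>\<epsilon> i j. i \<noteq> j \<Longrightarrow> A \<epsilon> $ i $ i \<noteq> A \<epsilon> $ j $ j"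
    and "\<And>\<epsilon> i. D \<epsilon> $ i $ i > 0"
    and "\<And>\<epsilon> l. l \<in> spectrum (map_matrix complex_of_real (D \<epsilon>)) \<Longrightarrow> Re l > 0"
  shows "\<not> (\<exists>\<epsilon>s. turing_instability_at A D \<epsilon>s)"
proof
  assume "\<exists>\<epsilon>s. turing_instability_at A D \<epsilon>s"
  then obtain \<epsilon>s \<xi>s where \<xi>s: "\<xi>s > 0"
    and crit: "max_Re_spectrum (fourier_symbol (A \<epsilon>s) (D \<epsilon>s) \<xi>s) = 0"
    unfolding turing_instability_at_def by blast
  obtain l where l: "l \<in> spectrum (fourier_symbol (A \<epsilon>s) (D \<epsilon>s) \<xi>s)" "Re l = 0"
    using max_Re_spectrum_attained crit by metis
  have "Re l < 0"
  proof (rule Re_spectrum_fourier_symbol_neg[OF _ _ _ _ _ _ l(1)])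
    show "D \<epsilon>s$1$2 * D \<epsilon>s$2$1 < D \<epsilon>s$1$1 * D \<epsilon>s$2$2"
      by (rule det_pos_if_spectrum_pos) (rule assms(6))
  qed (use \<xi>s assms(3,5) in auto)
  with l(2) show False
    by simp
qed

end
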